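(* Let $G=(V,E)$ be a (not necessarily regular) graph and let $k\ge 1$ be an integer. Then the supertoken graph $F_{k\times 1}^k(G)$ is isomorphic to the Cartesian product $G\,\Box\,\cdots\,\Box\, G$ of $k$ copies of $G$.
   Context: Graphs are finite, simple and undirected. The supertoken graph $F_{k\times 1}^k(G)$ is the graph whose vertices are the distributions of $k$ pairwise different (labelled) tokens $1,\ldots,k$ on the vertices of $G$, with any number of tokens, up to $k$, allowed on a vertex; two distributions are adjacent if one is obtained from the other by moving exactly one token from its current vertex $u$ to a vertex $v$ with $uv\in E$. The Cartesian product $G\,\Box\, H$ has vertex set $V(G)\times V(H)$, with $(g,h)$ adjacent to $(g',h')$ if and only if either $g=g'$ and $hh'\in E(H)$, or $h=h'$ and $gg'\in E(G)$. *)

theory Defs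
  imports
    "HOL-Library.FuncSet"
    "Graph_Theory.Pair_Digraph"
    "Graph_Theory.Digraph_Isomorphism"
begin

text \<open>
  A finite simple undirected graph is a \<open>pair_graph\<close>: a finite vertex set with a symmetric,
  irreflexive set of arcs, where an edge \<open>uv\<close> is the pair of arcs \<open>(u, v)\<close>, \<open>(v, u)\<close>.  On such
  graphs \<open>digraph_iso\<close> is graph isomorphism; see \<open>digraph_iso_with_proj_iff\<close> below.
\<close>

lemma digraph_iso_with_proj_iff:
  assumes "pair_wf_digraph G" and "pair_wf_digraph H"
  shows "digraph_iso (with_proj G) (with_proj H) \<longleftrightarrow>
    (\<exists>f. bij_betw f (pverts G) (pverts H) \<and>
      (\<forall>u\<in>pverts G. \<forall>v\<in>pverts G. (u, v) \<in> parcs G \<longleftrightarrow> (f u, f v) \<in> parcs H))"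
    (is "?L \<longleftrightarrow> ?R")
proof
  interpret G: pair_wf_digraph G by fact
  assume ?L
  then obtain f where f: "pre_digraph.digraph_isomorphism (with_proj G) f"
    and H: "with_proj H = app_iso f (with_proj G)"
    unfolding digraph_iso_def by blast
  let ?v = "iso_verts f" and ?a = "iso_arcs f"
  have V: "pverts H = ?v ` pverts G" and A: "parcs H = ?a ` parcs G"
    and T: "iso_tail f = fst" and D: "iso_head f = snd"
    using H by (auto simp: with_proj_def app_iso_def)
  have inj: "inj_on ?v (pverts G)"
    and ends: "\<forall>a\<in>parcs G. ?v (fst a) = iso_tail f (?a a) \<and> ?v (snd a) = iso_head f (?a a)"
    using f unfolding pre_digraph.digraph_isomorphism_def by simp_all
  have arc: "?a (u, v) = (?v u, ?v v)" if "(u, v) \<in> parcs G" for u v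
    using ends that by (force simp: T D prod_eq_iff)
  have "(u, v) \<in> parcs G \<longleftrightarrow> (?v u, ?v v) \<in> parcs H"
    if uv: "u \<in> pverts G" "v \<in> pverts G" for u v
  proof
    assume "(u, v) \<in> parcs G"
    then show "(?v u, ?v v) \<in> parcs H"
      unfolding A using arc by (metis imageI)
  next
    assume "(?v u, ?v v) \<in> parcs H"
    then obtain x y where xy: "(x, y) \<in> parcs G" "?a (x, y) = (?v u, ?v v)"
      unfolding A by (metis imageE surj_pair)
    then have "?v x = ?v u" "?v y = ?v v"
      using arc by auto
    then have "x = u" "y = v"
      using inj uv xy G.wellformed' unfolding inj_on_def by blast+
    then show "(u, v) \<in> parcs G"
      using xy by simp
  qed
  then show ?R
    using inj V by (intro exI[of _ ?v]) (auto simp: bij_betw_def)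
next
  interpret G: pair_wf_digraph G by fact
  interpret H: pair_wf_digraph H by fact
  assume ?R
  then obtain f where bij: "bij_betw f (pverts G) (pverts H)"
    and adj: "\<And>u v. u \<in> pverts G \<Longrightarrow> v \<in> pverts G \<Longrightarrow>
      (u, v) \<in> parcs G \<longleftrightarrow> (f u, f v) \<in> parcs H"
    by blast
  let ?i = "\<lparr>iso_verts = f, iso_arcs = map_prod f f, iso_head = snd, iso_tail = fst\<rparr>"
  have inj: "inj_on f (pverts G)" and img: "f ` pverts G = pverts H"
    using bij by (auto simp: bij_betw_def)
  have "inj_on (map_prod f f) (parcs G)"
  proof (rule inj_onI, clarsimp)
    fix a b c d
    assume "(a, b) \<in> parcs G" "(c, d) \<in> parcs G" "f a = f c" "f b = f d"
    then show "a = c \<and> b = d"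
      using inj G.wellformed' unfolding inj_on_def by blast
  qed
  then have "pre_digraph.digraph_isomorphism (with_proj G) ?i"
    using inj by (auto simp: pre_digraph.digraph_isomorphism_def G.wf_digraph_axioms)
  moreover have "map_prod f f ` parcs G = parcs H"
  proof (intro equalityI subsetI)
    fix e assume "e \<in> map_prod f f ` parcs G"
    then obtain u v where "(u, v) \<in> parcs G" "e = (f u, f v)"
      by auto
    then show "e \<in> parcs H"
      using adj[of u v] G.wellformed'[of u v] by blast
  next
    fix e assume e: "e \<in> parcs H"
    obtain x y where xy: "e = (x, y)" by fastforce
    then have "x \<in> f ` pverts G" "y \<in> f ` pverts G"
      using e H.wellformed' unfolding img by blast+
    then obtain u v where uv: "u \<in> pverts G" "v \<in> pverts G" "x = f u" "y = f v"
      by blast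
    then show "e \<in> map_prod f f ` parcs G"
      using adj[OF uv(1,2)] e xy uv(3,4) by (intro image_eqI[of _ _ "(u, v)"]) simp_all
  qed
  then have "with_proj H = app_iso ?i (with_proj G)"
    using img by (simp add: with_proj_def app_iso_def)
  ultimately show ?L
    unfolding digraph_iso_def by blast
qed

text \<open>
  A distribution of the labelled tokens \<open>1, \<dots>, k\<close> is the map sending each token to the vertex it
  lies on.  The bound on the number of tokens per vertex is the superscript of
  \<open>F\<^sub>k\<^sub>\<times>\<^sub>1\<^sup>k(G)\<close>; being \<open>k\<close>, it excludes no distribution.
\<close>

definition token_distributions :: "nat \<Rightarrow> 'a set \<Rightarrow> (nat \<Rightarrow> 'a) set" where
  "token_distributions k V =
    {d \<in> {1..k} \<rightarrow>\<^sub>E V. \<forall>v\<in>V. card {i \<in> {1..k}. d i = v} \<le> k}"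

definition supertoken_graph :: "nat \<Rightarrow> 'a pair_pre_digraph \<Rightarrow> (nat \<Rightarrow> 'a) pair_pre_digraph" where
  "supertoken_graph k G = \<lparr>
    pverts = token_distributions k (pverts G),
    parcs = {(d, d'). d \<in> token_distributions k (pverts G) \<and>
      d' \<in> token_distributions k (pverts G) \<and>
      (\<exists>i\<in>{1..k}. \<exists>u v. d i = u \<and> (u, v) \<in> parcs G \<and> d' = d(i := v))}\<rparr>"

definition cartesian_product ::
    "'a pair_pre_digraph \<Rightarrow> 'b pair_pre_digraph \<Rightarrow> ('a \<times> 'b) pair_pre_digraph"
    (infixl "\<box>" 70) where
  "G \<box> H = \<lparr>
    pverts = pverts G \<times> pverts H,
    parcs = {((g, h), (g', h')). (g, h) \<in> pverts G \<times> pverts H \<and>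
      (g', h') \<in> pverts G \<times> pverts H \<and>
      (g = g' \<and> (h, h') \<in> parcs H \<or> h = h' \<and> (g, g') \<in> parcs G)}\<rparr>"

definition relabel :: "('a \<Rightarrow> 'b) \<Rightarrow> 'a pair_pre_digraph \<Rightarrow> 'b pair_pre_digraph" where
  "relabel f G = \<lparr>pverts = f ` pverts G, parcs = map_prod f f ` parcs G\<rparr>"

text \<open>
  The \<open>k\<close>-fold product \<open>G \<box> \<dots> \<box> G\<close>, bracketed to the left.  The vertex type of a nested binary
  product depends on \<open>k\<close>, so nested pairs \<open>((v\<^sub>1, v\<^sub>2), \<dots>, v\<^sub>k)\<close> are flattened to lists
  \<open>[v\<^sub>1, \<dots>, v\<^sub>k]\<close>.  The flattening maps are injective, so each step is the binary product up to
  isomorphism (\<open>cartesian_power_1_iso\<close>, \<open>cartesian_power_Suc_iso\<close>).  The value at \<open>0\<close> is the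
  one-vertex graph.
\<close>

fun cartesian_power :: "'a pair_pre_digraph \<Rightarrow> nat \<Rightarrow> 'a list pair_pre_digraph" where
  "cartesian_power G 0 = \<lparr>pverts = {[]}, parcs = {}\<rparr>"
| "cartesian_power G (Suc 0) = relabel (\<lambda>v. [v]) G"
| "cartesian_power G (Suc (Suc k)) =
    relabel (\<lambda>(vs, v). vs @ [v]) (cartesian_power G (Suc k) \<box> G)"

lemma pair_graphI:
  assumes "finite (pverts G)"
    and "\<And>u v. (u, v) \<in> parcs G \<Longrightarrow> u \<in> pverts G \<and> v \<in> pverts G \<and> u \<noteq> v \<and> (v, u) \<in> parcs G"
  shows "pair_graph G"
proof -
  have "parcs G \<subseteq> pverts G \<times> pverts G"
    using assms(2) by auto
  then have "finite (parcs G)"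
    using assms(1) finite_subset by blast
  then show ?thesis
    using assms(1) by unfold_locales (auto simp: symmetric_def intro!: symI dest: assms(2))
qed

lemma pair_graphD:
  assumes "pair_graph G"
  shows "finite (pverts G)"
    and "(u, v) \<in> parcs G \<Longrightarrow> u \<in> pverts G \<and> v \<in> pverts G \<and> u \<noteq> v \<and> (v, u) \<in> parcs G"
proof -
  interpret pair_graph G by fact
  show "finite (pverts G)"
    by (rule pair_finite_verts)
  show "(u, v) \<in> parcs G \<Longrightarrow> u \<in> pverts G \<and> v \<in> pverts G \<and> u \<noteq> v \<and> (v, u) \<in> parcs G"
    using wellformed' no_loops' pair_sym_arcs
    by (metis symmetric_def symD with_proj_simps(3))
qed

lemma pair_graph_supertoken_graph:
  assumes "pair_graph G"
  shows "pair_graph (supertoken_graph k G)"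
proof (rule pair_graphI)
  show "finite (pverts (supertoken_graph k G))"
    using pair_graphD(1)[OF assms]
    by (auto simp: supertoken_graph_def token_distributions_def intro!: finite_PiE)
next
  fix d d' assume "(d, d') \<in> parcs (supertoken_graph k G)"
  then obtain i v where *: "d \<in> token_distributions k (pverts G)"
      "d' \<in> token_distributions k (pverts G)" "i \<in> {1..k}" "(d i, v) \<in> parcs G" "d' = d(i := v)"
    by (auto simp: supertoken_graph_def)
  have v: "d i \<noteq> v" "(v, d i) \<in> parcs G"
    using pair_graphD(2)[OF assms *(4)] by blast+
  have "d' i = v" "d'(i := d i) = d"
    using *(5) by simp_all
  then have "(d', d) \<in> parcs (supertoken_graph k G)"
    unfolding supertoken_graph_def using *(1-3) v(2) by force
  moreover have "d \<noteq> d'"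
    using v(1) \<open>d' i = v\<close> by blast
  ultimately show "d \<in> pverts (supertoken_graph k G) \<and> d' \<in> pverts (supertoken_graph k G) \<and>
      d \<noteq> d' \<and> (d', d) \<in> parcs (supertoken_graph k G)"
    using *(1,2) by (simp add: supertoken_graph_def)
qed

lemma pair_graph_cartesian_product:
  assumes "pair_graph G" and "pair_graph H"
  shows "pair_graph (G \<box> H)"
  using pair_graphD(1)[OF assms(1)] pair_graphD(1)[OF assms(2)]
  by (intro pair_graphI) (auto simp: cartesian_product_def
      dest: pair_graphD(2)[OF assms(1)] pair_graphD(2)[OF assms(2)])

lemma pair_graph_relabel:
  assumes "pair_graph G" and "inj_on f (pverts G)"
  shows "pair_graph (relabel f G)"
proof (rule pair_graphI)
  show "finite (pverts (relabel f G))"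
    using pair_graphD(1)[OF assms(1)] by (simp add: relabel_def)
next
  fix x y assume "(x, y) \<in> parcs (relabel f G)"
  then obtain u v where uv: "(u, v) \<in> parcs G" "x = f u" "y = f v"
    by (auto simp: relabel_def)
  note D = pair_graphD(2)[OF assms(1) uv(1)]
  then have "f u \<noteq> f v"
    using assms(2) by (auto simp: inj_on_eq_iff)
  then show "x \<in> pverts (relabel f G) \<and> y \<in> pverts (relabel f G) \<and> x \<noteq> y \<and>
      (y, x) \<in> parcs (relabel f G)"
    using D uv by (force simp: relabel_def)
qed

lemma relabel_iso:
  assumes "pair_graph G" and "inj_on f (pverts G)"
  shows "digraph_iso (with_proj G) (with_proj (relabel f G))"
proof -
  have wf: "pair_wf_digraph G" "pair_wf_digraph (relabel f G)"
    using assms pair_graph_relabel pair_graph.axioms(1) pair_digraph.axioms(1)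
      pair_fin_digraph.axioms(1) by blast+
  have "(u, v) \<in> parcs G \<longleftrightarrow> (f u, f v) \<in> parcs (relabel f G)"
    if "u \<in> pverts G" "v \<in> pverts G" for u v
  proof
    show "(u, v) \<in> parcs G \<Longrightarrow> (f u, f v) \<in> parcs (relabel f G)"
      by (force simp: relabel_def)
    assume "(f u, f v) \<in> parcs (relabel f G)"
    then obtain x y where xy: "(x, y) \<in> parcs G" "f x = f u" "f y = f v"
      by (auto simp: relabel_def)
    then have "x = u" "y = v"
      using that assms(2) pair_graphD(2)[OF assms(1) xy(1)] by (auto dest: inj_onD)
    then show "(u, v) \<in> parcs G"
      using xy by simp
  qed
  then show ?thesis
    using assms(2) unfolding digraph_iso_with_proj_iff[OF wf]
    by (intro exI[of _ f]) (auto simp: bij_betw_def relabel_def)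
qed

lemma inj_snoc: "inj_on (\<lambda>(vs, v). vs @ [v]) A"
  by (auto simp: inj_on_def)

lemma pair_graph_cartesian_power:
  assumes "pair_graph G"
  shows "pair_graph (cartesian_power G k)"
  using assms
proof (induction G k rule: cartesian_power.induct)
  case (1 G)
  show ?case by (rule pair_graphI) auto
next
  case (2 G)
  then show ?case by (auto intro!: pair_graph_relabel simp: inj_on_def)
next
  case (3 G k)
  show ?case
    unfolding cartesian_power.simps
    by (intro pair_graph_relabel pair_graph_cartesian_product inj_snoc 3)
qed

lemma cartesian_power_1_iso:
  assumes "pair_graph G"
  shows "digraph_iso (with_proj G) (with_proj (cartesian_power G 1))"
  using relabel_iso[OF assms, of "\<lambda>v. [v]"] by (simp add: inj_on_def)

lemma cartesian_power_Suc_iso: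
  assumes "pair_graph G" and "k \<ge> 1"
  shows "digraph_iso (with_proj (cartesian_power G k \<box> G)) (with_proj (cartesian_power G (Suc k)))"
proof -
  obtain j where "k = Suc j"
    using assms(2) by (cases k) auto
  then show ?thesis
    using assms(1) by (simp only: cartesian_power.simps)
      (intro relabel_iso inj_snoc pair_graph_cartesian_product pair_graph_cartesian_power)
qed

end

theory Submission
  imports Defs
begin

text \<open>A vertex never carries more than all \<open>k\<close> tokens, so distributions are just
  \<open>k\<close>-tuples of vertices, and a move changes one coordinate along an edge. Adjacency in
  the iterated product is the same relation: unfolding the recursion, either the last coordinate
  moves or the prefix does. \<open>arcs_cartesian_power\<close> puts this in closed form,
  \<open>bij_betw_map_upt_PiE\<close> matches functions with lists, and
  \<open>map_upt_fun_upd\<close> turns a function update into a list update.\<close>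

lemma token_distributions_eq_PiE: "token_distributions k V = {1..k} \<rightarrow>\<^sub>E V"
proof -
  have "card {i \<in> {1..k}. d i = v} \<le> k" for d :: "nat \<Rightarrow> 'a" and v
    by (metis (lifting) card_atLeastAtMost card_mono diff_Suc_1 finite_atLeastAtMost mem_Collect_eq subsetI)
  then show ?thesis
    by (auto simp: token_distributions_def)
qed

lemma verts_cartesian_power:
  "pverts (cartesian_power G k) = {xs. length xs = k \<and> set xs \<subseteq> pverts G}"
proof (induction G k rule: cartesian_power.induct)
  case (1 G)
  show ?case by auto
next
  case (2 G)
  show ?case by (auto simp: relabel_def length_Suc_conv)
next
  case (3 G k)
  have "xs \<in> (\<lambda>(vs, v). vs @ [v]) ` ({xs. length xs = Suc k \<and> set xs \<subseteq> pverts G} \<times> pverts G)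
    \<longleftrightarrow> length xs = Suc (Suc k) \<and> set xs \<subseteq> pverts G" for xs
    by (cases xs rule: rev_cases) auto
  then show ?case
    by (auto simp: relabel_def cartesian_product_def 3)
qed

text \<open>Injectivity on the whole type lets arcs be reflected without first knowing that
  \<open>u\<close> and \<open>v\<close> are vertices.\<close>

lemma arcs_relabel_iff:
  assumes "inj f"
  shows "(f u, f v) \<in> parcs (relabel f G) \<longleftrightarrow> (u, v) \<in> parcs G"
  using inj_image_mem_iff[OF prod.inj_map[OF assms assms], of "(u, v)"] by (simp add: relabel_def)

lemma arcs_cartesian_power_Suc_Suc:
  "(xs @ [x], ys @ [y]) \<in> parcs (cartesian_power G (Suc (Suc k))) \<longleftrightarrow>
    xs \<in> pverts (cartesian_power G (Suc k)) \<and> ys \<in> pverts (cartesian_power G (Suc k)) \<and>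
    x \<in> pverts G \<and> y \<in> pverts G \<and>
    (xs = ys \<and> (x, y) \<in> parcs G \<or> x = y \<and> (xs, ys) \<in> parcs (cartesian_power G (Suc k)))"
  using arcs_relabel_iff[OF inj_snoc, of "(xs, x)" "(ys, y)"] by (auto simp: cartesian_product_def)

text \<open>Only \<open>xs\<close> has to be required to be a vertex: \<open>v\<close> is the head
  of an arc of a well-formed graph, so the updated list is a vertex too.\<close>

lemma arcs_cartesian_power:
  assumes "pair_wf_digraph G"
  shows "(xs, ys) \<in> parcs (cartesian_power G k) \<longleftrightarrow>
    xs \<in> pverts (cartesian_power G k) \<and> (\<exists>i<k. \<exists>v. (xs ! i, v) \<in> parcs G \<and> ys = xs[i := v])"
  using assms
proof (induction G k arbitrary: xs ys rule: cartesian_power.induct)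
  case (1 G)
  show ?case by simp
next
  case (2 G)
  then interpret pair_wf_digraph G .
  show ?case by (force simp: relabel_def dest: wellformed')
next
  case (3 G k)
  interpret pair_wf_digraph G by (rule 3)
  show ?case (is "?L \<longleftrightarrow> ?R")
  proof (cases "length xs = Suc (Suc k) \<and> length ys = Suc (Suc k)")
    \<comment> \<open>Arcs join lists of full length, and \<open>list_update\<close> preserves
      length, so both sides fail.\<close>
    case False
    moreover have "pverts (cartesian_power G (Suc k)) \<subseteq> {xs. length xs = Suc k}"
      by (auto simp: verts_cartesian_power)
    ultimately have "\<not> ?L"
      by (auto simp: relabel_def cartesian_product_def)
    moreover have "\<not> ?R"
      using False by (auto simp: verts_cartesian_power simp del: cartesian_power.simps)
    ultimately show ?thesis by blast
  next
    case True
    then obtain as a bs b where [simp]: "xs = as @ [a]" "ys = bs @ [b]"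
      and len: "length as = Suc k" "length bs = Suc k"
      by (metis length_Suc_conv_rev)
    have upd: "set as \<subseteq> pverts G \<Longrightarrow> (as ! i, v) \<in> parcs G \<Longrightarrow> set (as[i := v]) \<subseteq> pverts G" for i v
      using wellformed'[of "as ! i" v] set_update_subset_insert[of as i v] by blast
    have "?L \<longleftrightarrow> set as \<subseteq> pverts G \<and> a \<in> pverts G \<and>
        (as = bs \<and> (a, b) \<in> parcs G \<or>
         a = b \<and> (\<exists>i<Suc k. \<exists>v. (as ! i, v) \<in> parcs G \<and> bs = as[i := v]))"
      unfolding \<open>xs = _\<close> \<open>ys = _\<close> arcs_cartesian_power_Suc_Suc 3(1)[OF 3(2)]
      using len upd wellformed' by (simp add: verts_cartesian_power) blast
    \<comment> \<open>The index \<open>i = Suc k\<close> changes the last entry and gives the first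
      disjunct; a smaller index changes the prefix \<open>as\<close> and gives the second.\<close>
    also have "\<dots> \<longleftrightarrow> ?R"
      using len by (auto simp: verts_cartesian_power nth_append list_update_append less_Suc_eq
          simp del: cartesian_power.simps)
    finally show ?thesis .
  qed
qed

text \<open>The inverse reads entry \<open>i - m\<close> at \<open>i\<close> and is
  \<open>undefined\<close> off the interval, as extensionality demands.\<close>

lemma bij_betw_map_upt_PiE:
  "bij_betw (\<lambda>d. map d [m..<n]) ({m..<n} \<rightarrow>\<^sub>E V) {xs. length xs = n - m \<and> set xs \<subseteq> V}"
proof (rule bij_betwI[where g = "\<lambda>xs. \<lambda>i\<in>{m..<n}. xs ! (i - m)"])
  show "(\<lambda>d. map d [m..<n]) \<in> ({m..<n} \<rightarrow>\<^sub>E V) \<rightarrow> {xs. length xs = n - m \<and> set xs \<subseteq> V}"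
    by auto
  show "(\<lambda>xs. \<lambda>i\<in>{m..<n}. xs ! (i - m)) \<in> {xs. length xs = n - m \<and> set xs \<subseteq> V} \<rightarrow> {m..<n} \<rightarrow>\<^sub>E V"
    by (auto simp: subset_iff)
  show "(\<lambda>i\<in>{m..<n}. map d [m..<n] ! (i - m)) = d" if "d \<in> {m..<n} \<rightarrow>\<^sub>E V" for d
    using that by (auto simp: fun_eq_iff PiE_def extensional_def)
  show "map (\<lambda>i\<in>{m..<n}. xs ! (i - m)) [m..<n] = xs"
    if "xs \<in> {xs. length xs = n - m \<and> set xs \<subseteq> V}" for xs
    using that by (intro nth_equalityI) auto
qed

lemma map_upt_fun_upd:
  assumes "i < n - m"
  shows "map (d(m + i := v)) [m..<n] = (map d [m..<n])[i := v]"
  using assms by (auto intro!: nth_equalityI simp: nth_list_update)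

text \<open>Listing the positions of the tokens \<open>1, \<dots>, k\<close> in order is the isomorphism: moving token
  \<open>i\<close> along an edge changes exactly the \<open>i\<close>-th coordinate along that edge.\<close>

theorem proposition8p1:
  fixes G :: "'a pair_pre_digraph" and k :: nat
  assumes "pair_graph G" and "k \<ge> 1"
  shows "digraph_iso (with_proj (supertoken_graph k G)) (with_proj (cartesian_power G k))"
proof -
  have wf: "pair_wf_digraph H" if "pair_graph H" for H :: "'b pair_pre_digraph"
    using that pair_graph.axioms(1) pair_digraph.axioms(1) pair_fin_digraph.axioms(1) by blast
  interpret pair_wf_digraph G
    using assms(1) by (rule wf)
  let ?V = "pverts G" and ?f = "\<lambda>d. map d [1..<Suc k]"
  have tokens: "token_distributions k ?V = {1..<Suc k} \<rightarrow>\<^sub>E ?V"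
    by (simp add: token_distributions_eq_PiE atLeastLessThanSuc_atLeastAtMost)
  have bij: "bij_betw ?f (pverts (supertoken_graph k G)) (pverts (cartesian_power G k))"
    using bij_betw_map_upt_PiE[of 1 "Suc k" ?V]
    by (simp add: supertoken_graph_def tokens verts_cartesian_power)
  have adj: "(d, d') \<in> parcs (supertoken_graph k G) \<longleftrightarrow> (?f d, ?f d') \<in> parcs (cartesian_power G k)"
    if d: "d \<in> {1..<Suc k} \<rightarrow>\<^sub>E ?V" and d': "d' \<in> {1..<Suc k} \<rightarrow>\<^sub>E ?V" for d d'
  proof -
    \<comment> \<open>Passing from lists back to functions uses injectivity of \<open>?f\<close>, so
      the updated function must again lie in the extensional function space. Token
      \<open>Suc i\<close> sits at list position \<open>i\<close>.\<close>
    have step: "?f d' = (?f d)[i := v] \<longleftrightarrow> d' = d(Suc i := v)"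
      if "i < k" "(d (Suc i), v) \<in> parcs G" for i v
    proof -
      have "d(Suc i := v) \<in> {1..<Suc k} \<rightarrow>\<^sub>E ?V"
        using d that wellformed'[OF that(2)] by (auto simp: PiE_def extensional_def)
      moreover have "(?f d)[i := v] = ?f (d(Suc i := v))"
        using map_upt_fun_upd[of i "Suc k" 1 d v] that(1) by (simp del: upt_Suc)
      ultimately show ?thesis
        using inj_on_eq_iff[OF bij_betw_imp_inj_on[OF bij_betw_map_upt_PiE] d'] by metis
    qed
    have nth: "?f d ! i = d (Suc i)" if "i < k" for i
      using that by (simp del: upt_Suc)
    have "(d, d') \<in> parcs (supertoken_graph k G) \<longleftrightarrow>
        (\<exists>i\<in>Suc ` {..<k}. \<exists>v. (d i, v) \<in> parcs G \<and> d' = d(i := v))"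
      using d d' by (simp add: supertoken_graph_def tokens image_Suc_lessThan)
    also have "\<dots> \<longleftrightarrow> (\<exists>i<k. \<exists>v. (d (Suc i), v) \<in> parcs G \<and> d' = d(Suc i := v))"
      by auto
    also have "\<dots> \<longleftrightarrow> (\<exists>i<k. \<exists>v. (?f d ! i, v) \<in> parcs G \<and> ?f d' = (?f d)[i := v])"
      using step nth by metis
    \<comment> \<open>The remaining condition, that \<open>?f d\<close> is a vertex of the power,
      comes from \<open>bij\<close>.\<close>
    also have "\<dots> \<longleftrightarrow> (?f d, ?f d') \<in> parcs (cartesian_power G k)"
      using d bij by (auto simp: arcs_cartesian_power[OF wf[OF assms(1)]] supertoken_graph_def tokens
          bij_betw_def simp del: upt_Suc)
    finally show ?thesis .
  qed
  show ?thesis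
    unfolding digraph_iso_with_proj_iff[OF wf[OF pair_graph_supertoken_graph[OF assms(1)]]
        wf[OF pair_graph_cartesian_power[OF assms(1)]]]
    using bij adj by (intro exI[of _ ?f]) (simp add: supertoken_graph_def tokens)
qed

end
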